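(* Let $p<q$ be odd prime numbers, let $\lfloor q/p\rfloor$ be the quotient and let $r$ be the remainder of the division of $q$ by $p$. (1) If $p=3$, then $\Phi_{3q}$ has exactly $2\lfloor q/3\rfloor$ gaps of length $2$. (2) If $p\ge 5$ and $r=1$, then $\Phi_{pq}$ has exactly $2\lfloor q/p\rfloor$ gaps of length $i$ for each $2\le i\le p-1$. (3) If $p\ge 5$ and $r=p-1$, then $\Phi_{pq}$ has exactly $2\lfloor q/p\rfloor$ gaps of length $p-1$, and exactly $2\lfloor q/p\rfloor+2$ gaps of length $i$ for each $2\le i\le p-2$.
   Context: $\Phi_n(X)\in\mathbb{Z}[X]$ denotes the cyclotomic polynomial of order $n$. For a polynomial $\Phi=c_nX^{e_n}+c_{n-1}X^{e_{n-1}}+\cdots+c_0X^{e_0}$ with all $c_j$ nonzero and $e_n>e_{n-1}>\cdots>e_0$, the gaps of $\Phi$ are the differences $e_{j+1}-e_j$, $0\le j\le n-1$, that are different from $1$. The number of gaps of length $i\ge 2$ of $\Phi$ is the number of indices $j\in\{0,\dots,n-1\}$ with $e_{j+1}-e_j=i$. *)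

theory Defs
  imports "HOL-Computational_Algebra.Computational_Algebra"
begin

definition primitive_roots_unity :: "nat \<Rightarrow> complex set" where
  "primitive_roots_unity n = {z. z ^ n = 1 \<and> (\<forall>m. 0 < m \<and> m < n \<longrightarrow> z ^ m \<noteq> 1)}"

(* The lemma map_poly_cyclotomic below shows that the description is proper for n > 0. *)
definition cyclotomic :: "nat \<Rightarrow> int poly" where
  "cyclotomic n =
    (THE P. (map_poly of_int P :: complex poly) = (\<Prod>z\<in>primitive_roots_unity n. [:- z, 1:]))"

definition exponents :: "'a::zero poly \<Rightarrow> nat list" where
  "exponents P = sorted_list_of_set {k. coeff P k \<noteq> 0}"

(* Meant for i \<ge> 2: a difference equal to 1 is not a gap. *)
definition num_gaps :: "'a::zero poly \<Rightarrow> nat \<Rightarrow> nat" where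
  "num_gaps P i =
    card {j. Suc j < length (exponents P) \<and> exponents P ! Suc j - exponents P ! j = i}"

lemma finite_support_poly: "finite {k. coeff (P :: 'a::zero poly) k \<noteq> 0}"
  by (rule finite_subset[of _ "{..degree P}"]) (auto intro: le_degree)

lemma set_exponents [simp]: "set (exponents P) = {k. coeff P k \<noteq> 0}"
  by (simp add: exponents_def finite_support_poly)

lemma strict_sorted_exponents: "sorted_wrt (<) (exponents P)"
  by (simp add: exponents_def)

abbreviation (input) ipoly :: "int poly \<Rightarrow> complex poly" where
  "ipoly \<equiv> map_poly of_int"

lemma ipoly_mult: "ipoly (P * Q) = ipoly P * ipoly Q"
  by (rule poly_eqI) (simp add: coeff_map_poly coeff_mult)

lemma ipoly_add: "ipoly (P + Q) = ipoly P + ipoly Q"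
  by (rule poly_eqI) (simp add: coeff_map_poly)

lemma ipoly_prod: "ipoly (\<Prod>x\<in>A. f x) = (\<Prod>x\<in>A. ipoly (f x))"
  by (induction A rule: infinite_finite_induct) (simp_all add: ipoly_mult)

lemma ipoly_inj: "ipoly P = ipoly Q \<Longrightarrow> P = Q"
  by (simp add: poly_eq_iff coeff_map_poly)

lemma degree_ipoly: "degree (ipoly P) = degree P"
  by (rule degree_map_poly) simp

lemma monic_divmod:
  fixes f g :: "int poly"
  assumes "lead_coeff g = 1"
  shows "\<exists>q r. f = g * q + r \<and> (r = 0 \<or> degree r < degree g)"
proof -
  obtain q r where qr: "pseudo_divmod f g = (q, r)"
    by force
  have "g \<noteq> 0" using assms by auto
  from pseudo_divmod[OF this qr] show ?thesis using assms by auto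
qed

lemma primitive_roots_unity_eq_order:
  assumes "n > 0"
  shows "{z::complex. z ^ n = 1} = (\<Union>d\<in>{d. d dvd n}. primitive_roots_unity d)"
proof (intro equalityI subsetI)
  fix z :: complex assume "z \<in> {z. z ^ n = 1}"
  hence z: "z ^ n = 1" by simp
  define d where "d = (LEAST m. m > 0 \<and> z ^ m = 1)"
  have d: "d > 0 \<and> z ^ d = 1"
    unfolding d_def by (rule LeastI[of _ n]) (use assms z in simp)
  have least: "z ^ m \<noteq> 1" if "0 < m" "m < d" for m
    using not_less_Least[of m "\<lambda>m. m > 0 \<and> z ^ m = 1"] that by (auto simp: d_def)
  have "z ^ (n mod d) = z ^ (n div d * d + n mod d)"
    using d by (simp only: power_add power_mult mult.commute[of _ d]) simp
  hence "z ^ (n mod d) = 1" using z by simp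
  hence "n mod d = 0" using least[of "n mod d"] d by auto
  thus "z \<in> (\<Union>d\<in>{d. d dvd n}. primitive_roots_unity d)"
    using d least by (auto simp: primitive_roots_unity_def)
next
  fix z assume "z \<in> (\<Union>d\<in>{d. d dvd n}. primitive_roots_unity d)"
  thus "z \<in> {z. z ^ n = 1}"
    by (auto simp: primitive_roots_unity_def dvd_def power_mult)
qed

lemma finite_primitive_roots_unity: "n > 0 \<Longrightarrow> finite (primitive_roots_unity n)"
  by (rule finite_subset[OF _ finite_roots_unity[of n]]) (auto simp: primitive_roots_unity_def)

lemma primitive_roots_unity_disjoint:
  assumes "0 < d" "0 < e" "d \<noteq> e"
  shows "primitive_roots_unity d \<inter> primitive_roots_unity e = {}"
  using assms by (fastforce simp: primitive_roots_unity_def neq_iff)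

lemma monic_prod_linear:
  "lead_coeff (\<Prod>z\<in>A. [:- z, 1::complex:]) = 1"
  "finite A \<Longrightarrow> degree (\<Prod>z\<in>A. [:- z, 1::complex:]) = card A"
proof -
  show "lead_coeff (\<Prod>z\<in>A. [:- z, 1::complex:]) = 1"
    by (simp add: lead_coeff_prod)
  show "degree (\<Prod>z\<in>A. [:- z, 1::complex:]) = card A" if "finite A"
    using that by (subst degree_prod_eq_sum_degree) auto
qed

lemma prod_roots_unity:
  assumes "n > 0"
  shows "(\<Prod>z | z ^ n = 1. [:- z, 1::complex:]) = monom 1 n - 1" (is "?P = ?Q")
proof (rule ccontr)
  assume ne: "?P \<noteq> ?Q"
  let ?A = "{z::complex. z ^ n = 1}"
  have fin: "finite ?A" using assms by (simp add: finite_roots_unity)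
  have card: "card ?A = n" using assms by (rule card_roots_unity_eq)
  have degP: "degree ?P = n" using monic_prod_linear(2)[OF fin] card by simp
  have cP: "coeff ?P n = 1" using monic_prod_linear(1)[of ?A] degP by simp
  have cQ: "coeff ?Q n = 1" using assms by simp
  have degQ: "degree ?Q \<le> n" by (rule degree_diff_le) (auto simp: degree_monom_le)
  have "degree (?P - ?Q) \<le> n" using degP degQ by (simp only: degree_diff_le)
  moreover have "coeff (?P - ?Q) n = 0" using cP cQ by simp
  ultimately have "degree (?P - ?Q) < n"
    using ne by (metis eq_iff_diff_eq_0 leading_coeff_0_iff le_neq_implies_less)
  moreover have "?A \<subseteq> {z. poly (?P - ?Q) z = 0}"
    using fin by (auto simp: poly_prod poly_monom)
  hence "card ?A \<le> card {z. poly (?P - ?Q) z = 0}"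
    using ne by (intro card_mono poly_roots_finite) auto
  moreover have "card {z. poly (?P - ?Q) z = 0} \<le> degree (?P - ?Q)"
    using ne by (intro card_poly_roots_bound) auto
  ultimately show False using card by linarith
qed

lemma prod_primitive_roots_unity:
  assumes "n > 0"
  shows "(\<Prod>d | d dvd n. \<Prod>z\<in>primitive_roots_unity d. [:- z, 1:]) = monom 1 n - 1"
proof -
  have "(\<Prod>z | z ^ n = 1. [:- z, 1::complex:]) =
      (\<Prod>d | d dvd n. \<Prod>z\<in>primitive_roots_unity d. [:- z, 1:])"
    unfolding primitive_roots_unity_eq_order[OF assms] using assms
    by (intro prod.UNION_disjoint ballI impI finite_primitive_roots_unity
        primitive_roots_unity_disjoint) (auto dest: dvd_pos_nat)
  thus ?thesis using prod_roots_unity[OF assms] by simp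
qed

lemma cyclotomic_exists:
  "n > 0 \<Longrightarrow> \<exists>P. ipoly P = (\<Prod>z\<in>primitive_roots_unity n. [:- z, 1:])"
proof (induction n rule: less_induct)
  case (less n)
  define C where "C = (\<lambda>d. \<Prod>z\<in>primitive_roots_unity d. [:- z, 1::complex:])"
  let ?D = "{d. d dvd n \<and> d \<noteq> n}"
  have "\<forall>d\<in>?D. \<exists>P. ipoly P = C d"
    using less unfolding C_def by (auto dest: dvd_imp_le dvd_pos_nat intro!: less.IH)
  then obtain F where F: "\<And>d. d \<in> ?D \<Longrightarrow> ipoly (F d) = C d"
    by metis
  define g where "g = (\<Prod>d\<in>?D. F d)"
  have g: "ipoly g = (\<Prod>d\<in>?D. C d)"
    unfolding g_def ipoly_prod using F by (intro prod.cong) auto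
  have "lead_coeff (ipoly g) = 1"
    unfolding g lead_coeff_prod by (intro prod.neutral) (simp add: C_def monic_prod_linear)
  hence monic: "lead_coeff g = 1" by (simp add: degree_ipoly coeff_map_poly)
  obtain q r where qr: "monom 1 n - 1 = g * q + r" "r = 0 \<or> degree r < degree g"
    using monic_divmod[OF monic] by blast
  have "{d. d dvd n} = insert n ?D" by auto
  hence "monom 1 n - 1 = (\<Prod>d\<in>insert n ?D. C d)"
    using prod_primitive_roots_unity[OF less.prems] by (simp add: C_def)
  also have "\<dots> = C n * ipoly g"
    using less.prems by (subst prod.insert) (auto simp: g)
  finally have "C n * ipoly g = monom 1 n - 1" by simp
  also have "\<dots> = ipoly (monom 1 n - 1)"
    by (rule poly_eqI) (simp add: coeff_map_poly coeff_1)
  also have "\<dots> = ipoly g * ipoly q + ipoly r"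
    by (simp only: qr(1) ipoly_add ipoly_mult)
  finally have eq: "ipoly g * (C n - ipoly q) = ipoly r"
    by (simp add: algebra_simps)
  have "C n = ipoly q"
  proof (rule ccontr)
    assume ne: "C n \<noteq> ipoly q"
    have "ipoly g \<noteq> 0" using \<open>lead_coeff (ipoly g) = 1\<close> by auto
    hence "degree (ipoly r) = degree (ipoly g) + degree (C n - ipoly q)" "ipoly r \<noteq> 0"
      using ne unfolding eq[symmetric] by (auto intro: degree_mult_eq)
    thus False using qr(2) by (auto simp: degree_ipoly)
  qed
  thus ?case by (auto simp: C_def)
qed

theorem map_poly_cyclotomic:
  assumes "n > 0"
  shows "(map_poly of_int (cyclotomic n) :: complex poly) =
    (\<Prod>z\<in>primitive_roots_unity n. [:- z, 1:])"
proof -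
  have "\<exists>!P. ipoly P = (\<Prod>z\<in>primitive_roots_unity n. [:- z, 1:])"
    using cyclotomic_exists[OF assms] ipoly_inj by metis
  from theI'[OF this] show ?thesis unfolding cyclotomic_def .
qed

end

theory Submission
  imports Defs "HOL-Number_Theory.Cong"
begin

text \<open>
  Write \<open>S\<close> for the numerical semigroup generated by \<open>p\<close> and \<open>q\<close>. The proof rests on the identity
  \<open>\<Phi>\<^sub>p\<^sub>q(X) = (1 - X) \<cdot> (\<Sum>s\<in>S. X\<^sup>s)\<close> of formal power series, here in the coefficientwise form
  \<open>coeff_cyclotomic_prime_prod\<close>. It says that \<open>k\<close> is an exponent of \<open>\<Phi>\<^sub>p\<^sub>q\<close> exactly if one of \<open>k\<close>
  and \<open>k - 1\<close> is in \<open>S\<close> and the other is not. The exponents are thus the points at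
  which the runs of consecutive elements of \<open>S\<close> begin and end, and the gaps of \<open>\<Phi>\<^sub>p\<^sub>q\<close> are the
  lengths, different from 1, of the bounded maximal runs inside \<open>S\<close> and inside its complement
  (\<open>num_gaps_runs\<close>).

  If \<open>q \<equiv> \<plusminus>1\<close> modulo \<open>p\<close>, then the runs can be written down. An \<open>n\<close> lies in \<open>S\<close> if and only if the
  unique multiple \<open>c q\<close> with \<open>0 \<le> c < p\<close> and \<open>c q \<equiv> n\<close> modulo \<open>p\<close> is at most \<open>n\<close>
  (\<open>semigroup_gen_iff_class\<close>), and \<open>c\<close> is simply the residue of \<open>\<plusminus>n\<close>. For \<open>q = k p + 1\<close> the
  bounded runs of \<open>S\<close> are \<open>m p, \<dots>, m p + \<lfloor>m / k\<rfloor>\<close>; for \<open>q = k p - 1\<close> they are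
  \<open>m p - \<lfloor>m / k\<rfloor>, \<dots>, m p\<close>. As \<open>m\<close> grows, the run length stays the same for \<open>k\<close> steps and then
  increases by one, while the length of the holes between the runs decreases in the same way. Each
  length from 2 to \<open>p - 1\<close> hence occurs \<open>k\<close> times among the runs and \<open>k\<close> times among the holes, with
  one exception in the case \<open>q = k p - 1\<close>, where \<open>k = \<lfloor>q / p\<rfloor> + 1\<close>: the length \<open>p - 1\<close> loses
  one hole, because no hole precedes the run \<open>m = 0\<close>, and one run, because the last run of that
  length is adjacent to the next one and so belongs to the unbounded run.
\<close>

section \<open>The cyclotomic polynomial of order \<open>pq\<close> and the semigroup generated by \<open>p\<close> and \<open>q\<close>\<close>

lemma prod_cyclotomic:
  assumes "n > 0"
  shows "(\<Prod>d | d dvd n. cyclotomic d) = monom 1 n - 1"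
proof (rule ipoly_inj)
  have "ipoly (\<Prod>d | d dvd n. cyclotomic d) =
      (\<Prod>d | d dvd n. \<Prod>z\<in>primitive_roots_unity d. [:- z, 1:])"
    unfolding ipoly_prod using assms
    by (intro prod.cong refl map_poly_cyclotomic) (auto dest: dvd_pos_nat)
  also have "\<dots> = monom 1 n - 1"
    by (rule prod_primitive_roots_unity[OF assms])
  also have "\<dots> = ipoly (monom 1 n - 1)"
    by (rule poly_eqI) (simp add: coeff_map_poly coeff_1)
  finally show "ipoly (\<Prod>d | d dvd n. cyclotomic d) = ipoly (monom 1 n - 1)" .
qed

lemma divisors_prime_prod:
  fixes p q :: nat
  assumes "prime p" "prime q"
  shows "{d. d dvd p * q} = {1, p, q, p * q}"
proof (intro equalityI subsetI)
  fix d assume "d \<in> {d. d dvd p * q}"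
  then obtain a b where "d = a * b" "a dvd p" "b dvd q"
    by (auto elim: division_decomp[THEN exE])
  moreover from this have "a = 1 \<or> a = p" "b = 1 \<or> b = q"
    using assms prime_nat_iff by blast+
  ultimately show "d \<in> {1, p, q, p * q}"
    by auto
qed auto

text \<open>
  This is \<open>\<Phi>\<^sub>p\<^sub>q(X) \<Phi>\<^sub>p(X) = \<Phi>\<^sub>p(X\<^sup>q)\<close>, multiplied by \<open>X - 1\<close> so that only a binomial stands next
  to \<open>\<Phi>\<^sub>p\<^sub>q\<close> and coefficients can be compared.
\<close>
lemma cyclotomic_prime_prod_mult:
  fixes p q :: nat
  assumes "prime p" "prime q" "p \<noteq> q"
  shows "(monom 1 p - 1) * cyclotomic (p * q) = (monom 1 1 - 1) * (\<Sum>b<p. monom 1 (b * q))"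
proof -
  have pos: "p > 1" "q > 1" using assms(1,2) prime_gt_1_nat by blast+
  have div_p: "{d. d dvd p} = {1, p}" and div_q: "{d. d dvd q} = {1, q}"
    using assms by (auto simp: prime_nat_iff)
  have c1: "cyclotomic 1 = monom 1 1 - 1"
    using prod_cyclotomic[of 1] by simp
  have cp: "cyclotomic 1 * cyclotomic p = monom 1 p - 1"
    using prod_cyclotomic[of p] pos by (simp add: div_p)
  have cq: "cyclotomic 1 * cyclotomic q = monom 1 q - 1"
    using prod_cyclotomic[of q] pos by (simp add: div_q)
  have "cyclotomic 1 * (cyclotomic p * (cyclotomic q * cyclotomic (p * q))) = monom 1 (p * q) - 1"
    using prod_cyclotomic[of "p * q"] pos assms(3)
    by (simp add: divisors_prime_prod[OF assms(1,2)])
  also have "\<dots> = monom 1 q ^ p - 1"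
    by (simp add: monom_power mult.commute)
  also have "\<dots> = (monom 1 q - 1) * (\<Sum>b<p. monom 1 (b * q))"
    by (subst power_diff_1_eq) (simp add: monom_power mult.commute)
  finally have "(monom 1 q - 1) * (cyclotomic p * cyclotomic (p * q)) =
      (monom 1 q - 1) * (\<Sum>b<p. monom 1 (b * q) :: int poly)"
    unfolding cq[symmetric] by (simp only: mult_ac)
  moreover have "coeff (monom 1 q - 1 :: int poly) q \<noteq> 0"
    using pos by simp
  hence "monom 1 q - 1 \<noteq> (0 :: int poly)"
    by (metis coeff_0)
  ultimately have "cyclotomic p * cyclotomic (p * q) = (\<Sum>b<p. monom 1 (b * q))"
    by simp
  thus ?thesis
    by (simp only: cp[symmetric] c1[symmetric] mult.assoc)
qed

definition semigroup_gen :: "nat \<Rightarrow> nat \<Rightarrow> nat set" where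
  "semigroup_gen p q = {a * p + b * q | a b. True}"

lemma semigroup_gen_normal_form:
  assumes "n \<in> semigroup_gen p q" "p > 0"
  obtains a b where "n = a * p + b * q" "b < p"
proof -
  obtain a b where "n = a * p + b * q"
    using assms(1) by (auto simp: semigroup_gen_def)
  also have "\<dots> = a * p + (b div p * p + b mod p) * q"
    by simp
  also have "\<dots> = (a + b div p * q) * p + b mod p * q"
    by (simp only: algebra_simps)
  finally show ?thesis
    using that assms(2) by simp
qed

lemma semigroup_gen_shift:
  assumes "p > 0" "p \<le> n"
  shows "n \<in> semigroup_gen p q \<longleftrightarrow> n - p \<in> semigroup_gen p q \<or> (\<exists>b<p. n = b * q)"
proof
  assume "n \<in> semigroup_gen p q"
  then obtain a b where ab: "n = a * p + b * q" "b < p"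
    using assms by (auto elim: semigroup_gen_normal_form)
  show "n - p \<in> semigroup_gen p q \<or> (\<exists>b<p. n = b * q)"
  proof (cases a)
    case 0
    thus ?thesis using ab by auto
  next
    case (Suc a')
    hence "n - p = a' * p + b * q" using ab by simp
    thus ?thesis by (auto simp: semigroup_gen_def)
  qed
next
  assume "n - p \<in> semigroup_gen p q \<or> (\<exists>b<p. n = b * q)"
  thus "n \<in> semigroup_gen p q"
  proof
    assume "n - p \<in> semigroup_gen p q"
    then obtain a b where "n - p = a * p + b * q"
      by (auto simp: semigroup_gen_def)
    hence "n = Suc a * p + b * q" using assms by simp
    thus ?thesis by (auto simp only: semigroup_gen_def)
  next
    assume "\<exists>b<p. n = b * q"
    then obtain b where "n = 0 * p + b * q" by auto
    thus ?thesis by (auto simp only: semigroup_gen_def)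
  qed
qed

text \<open>
  The multiples \<open>b q\<close> with \<open>b < p\<close> are the smallest elements of the semigroup in their residue
  classes modulo \<open>p\<close>.
\<close>
lemma multiple_minimal_in_class:
  assumes "coprime p q" "b < p" "p \<le> b * q"
  shows "b * q - p \<notin> semigroup_gen p q"
proof
  assume "b * q - p \<in> semigroup_gen p q"
  then obtain a c where ac: "b * q - p = a * p + c * q"
    by (auto simp: semigroup_gen_def)
  hence eq: "b * q = Suc a * p + c * q" using assms(3) by simp
  hence "(b - c) * q = Suc a * p" by (simp add: diff_mult_distrib)
  hence "p dvd (b - c) * q" by simp
  hence "p dvd b - c" using assms(1) by (simp add: coprime_dvd_mult_left_iff)
  moreover have "b - c < p" using assms(2) by simp
  ultimately have "b - c = 0" by (auto dest: nat_dvd_not_less)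
  hence "b * q \<le> c * q" by (intro mult_le_mono1) simp
  thus False using eq assms(2) by simp
qed

text \<open>
  The indicator function \<open>s\<close> of the semigroup, taken to be 0 at negative arguments, satisfies
  \<open>s n - s (n - p) = [n \<in> {0, q, \<dots>, (p - 1) q}]\<close>. By \<open>cyclotomic_prime_prod_mult\<close>, the coefficients
  of \<open>\<Phi>\<^sub>p\<^sub>q\<close> and the differences \<open>s n - s (n - 1)\<close> hence satisfy the same recursion with step \<open>p\<close>.
\<close>
lemma coeff_cyclotomic_prime_prod:
  fixes p q n :: nat
  assumes "prime p" "prime q" "p \<noteq> q"
  defines "S \<equiv> semigroup_gen p q"
  shows "coeff (cyclotomic (p * q)) n = of_bool (n \<in> S) - of_bool (0 < n \<and> n - 1 \<in> S)"
proof -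
  have p1: "p > 1" and q1: "q > 1" using assms(1,2) prime_gt_1_nat by blast+
  have cop: "coprime p q" using assms by (simp add: primes_coprime)
  define s where "s n = (of_bool (n \<in> S) :: int)" for n
  define t where "t n = (of_bool (\<exists>b<p. n = b * q) :: int)" for n
  have s_small: "s n = t n" if "n < p" for n
  proof -
    have "n \<in> S \<longleftrightarrow> (\<exists>b<p. n = b * q)"
    proof
      assume "n \<in> S"
      then obtain a b where "n = a * p + b * q" "b < p"
        using p1 unfolding S_def by (auto elim: semigroup_gen_normal_form)
      moreover from this have "a = 0" using that by (cases a) auto
      ultimately show "\<exists>b<p. n = b * q" by auto
    next
      assume "\<exists>b<p. n = b * q"
      then obtain b where "n = 0 * p + b * q" by auto
      thus "n \<in> S" unfolding S_def semigroup_gen_def by blast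
    qed
    thus ?thesis by (simp add: s_def t_def)
  qed
  have s_rec: "s n = s (n - p) + t n" if "p \<le> n" for n
    using semigroup_gen_shift[of p n q] multiple_minimal_in_class[OF cop] p1 that
    by (auto simp: s_def t_def S_def)
  have coeff_sum: "coeff (\<Sum>b<p. monom 1 (b * q)) n = t n" for n
  proof (cases "\<exists>b<p. n = b * q")
    case True
    then obtain c where c: "c < p" "n = c * q" by auto
    have "coeff (\<Sum>b<p. monom 1 (b * q)) n = (\<Sum>b<p. if b = c then 1 else 0 :: int)"
      unfolding coeff_sum using q1 c by (intro sum.cong) auto
    thus ?thesis using c True by (simp add: t_def)
  next
    case False
    thus ?thesis by (auto simp: coeff_sum t_def intro!: sum.neutral)
  qed
  define c where "c = coeff (cyclotomic (p * q))"
  have rec: "(if n < p then 0 else c (n - p)) - c n = (if n < 1 then 0 else t (n - 1)) - t n" for n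
  proof -
    have "coeff ((monom 1 p - 1) * cyclotomic (p * q)) n =
        coeff ((monom 1 1 - 1) * (\<Sum>b<p. monom 1 (b * q))) n"
      by (simp only: cyclotomic_prime_prod_mult[OF assms(1-3)])
    thus ?thesis
      unfolding left_diff_distrib mult_1_left coeff_diff coeff_monom_mult coeff_sum
      by (simp only: c_def mult_1_left)
  qed
  have "c n = s n - (if n = 0 then 0 else s (n - 1))"
  proof (induction n rule: less_induct)
    case (less n)
    consider "n = 0" | "0 < n" "n < p" | "n = p" | "n > p" by linarith
    thus ?case
    proof cases
      case 1
      thus ?thesis using rec[of n] s_small[of n] p1 by simp
    next
      case 2
      thus ?thesis using rec[of n] s_small[of n] s_small[of "n - 1"] by simp
    next
      case 3
      thus ?thesis
        using rec[of n] s_rec[of n] s_small[of "n - 1"] less.IH[of "n - p"] p1 by simp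
    next
      case 4
      have "n - 1 - p = n - p - 1" by simp
      thus ?thesis
        using 4 rec[of n] s_rec[of n] s_rec[of "n - 1"] less.IH[of "n - p"] p1 by simp
    qed
  qed
  thus ?thesis by (simp add: c_def s_def)
qed

section \<open>Gaps as run lengths\<close>

lemma num_gaps_enum:
  assumes "{k. coeff P k \<noteq> 0} = e ` {..<n}" "strict_mono_on {..<n} e"
  shows "num_gaps P i = card {j. Suc j < n \<and> e (Suc j) - e j = i}"
proof -
  have sorted: "sorted_wrt (<) (map e [0..<n])"
    using assms(2) by (auto simp: sorted_wrt_iff_nth_less strict_mono_on_def)
  have "exponents P = map e [0..<n]"
    unfolding exponents_def assms(1)
    using sorted sorted_list_of_set.idem_if_sorted_distinct[of "map e [0..<n]"]
    by (simp add: strict_sorted_iff atLeast0LessThan)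
  thus ?thesis
    unfolding num_gaps_def by (intro arg_cong[of _ _ card]) auto
qed

text \<open>
  Reading \<open>a m\<close> as the beginning of a run and \<open>b m\<close> as the first number after it, the first
  cardinality counts run lengths and the second one the lengths of the holes between the runs.
\<close>
lemma num_gaps_runs:
  assumes ab: "\<And>m. m < N \<Longrightarrow> a m < b m"
    and ba: "\<And>m. m < N \<Longrightarrow> b m < a (Suc m)"
    and support: "{k. coeff P k \<noteq> 0} = a ` {..N} \<union> b ` {..<N}"
  shows "num_gaps P i =
    card {m. m < N \<and> b m - a m = i} + card {m. m < N \<and> a (Suc m) - b m = i}"
proof -
  define e where "e j = (if even j then a (j div 2) else b (j div 2))" for j
  have e_even: "e (2 * m) = a m" and e_odd: "e (2 * m + 1) = b m" for m
    by (simp_all add: e_def)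
  have step: "e j < e (Suc j)" if "Suc j < 2 * N + 1" for j
    using that ab[of "j div 2"] ba[of "j div 2"] by (auto simp: e_def elim!: evenE oddE)
  have mono: "i < j \<Longrightarrow> j < 2 * N + 1 \<Longrightarrow> e i < e j" for i j
  proof (induction j)
    case (Suc j)
    thus ?case using step[of j] by (cases "i = j") auto
  qed simp
  have "e ` {..<2 * N + 1} = a ` {..N} \<union> b ` {..<N}"
  proof (intro equalityI subsetI)
    fix x assume "x \<in> e ` {..<2 * N + 1}"
    then obtain j where "j < 2 * N + 1" "x = e j" by auto
    thus "x \<in> a ` {..N} \<union> b ` {..<N}"
      by (cases "even j") (auto simp: e_def elim!: evenE oddE)
  next
    fix x assume "x \<in> a ` {..N} \<union> b ` {..<N}"
    then consider m where "m \<le> N" "x = e (2 * m)" | m where "m < N" "x = e (2 * m + 1)"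
      using e_even e_odd by fastforce
    thus "x \<in> e ` {..<2 * N + 1}"
      by cases auto
  qed
  hence "num_gaps P i = card {j. Suc j < 2 * N + 1 \<and> e (Suc j) - e j = i}"
    using mono by (intro num_gaps_enum) (auto simp: support strict_mono_on_def)
  also have "{j. Suc j < 2 * N + 1 \<and> e (Suc j) - e j = i} =
      (\<lambda>m. 2 * m) ` {m. m < N \<and> b m - a m = i} \<union>
      (\<lambda>m. 2 * m + 1) ` {m. m < N \<and> a (Suc m) - b m = i}" (is "?J = ?A \<union> ?B")
  proof (intro equalityI subsetI)
    fix j assume "j \<in> ?J"
    thus "j \<in> ?A \<union> ?B"
      by (cases "even j") (auto simp: e_def elim!: evenE oddE)
  next
    fix j assume "j \<in> ?A \<union> ?B"
    thus "j \<in> ?J" by (auto simp: e_def)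
  qed
  also have "card (?A \<union> ?B) = card ?A + card ?B"
  proof (rule card_Un_disjoint)
    show "?A \<inter> ?B = {}" by auto presburger
  qed auto
  finally show ?thesis
    by (simp add: card_image inj_on_def)
qed

text \<open>
  The hypotheses describe the semigroup as the disjoint union of the maximal runs
  \<open>a m, \<dots>, b m - 1\<close> for \<open>m < N\<close> and of an unbounded run that starts at \<open>a N\<close>.
\<close>
lemma num_gaps_cyclotomic_runs:
  fixes p q :: nat
  assumes "prime p" "prime q" "p \<noteq> q"
    and ab: "\<And>m. m < N \<Longrightarrow> a m < b m"
    and ba: "\<And>m. m < N \<Longrightarrow> b m < a (Suc m)"
    and S: "\<And>n. n \<in> semigroup_gen p q \<longleftrightarrow> a N \<le> n \<or> (\<exists>m<N. a m \<le> n \<and> n < b m)"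
  shows "num_gaps (cyclotomic (p * q)) i =
    card {m. m < N \<and> b m - a m = i} + card {m. m < N \<and> a (Suc m) - b m = i}"
proof (intro num_gaps_runs ab ba equalityI subsetI)
  let ?S = "semigroup_gen p q"
  note coeff = coeff_cyclotomic_prime_prod[OF assms(1-3)]
  have later: "m < m' \<Longrightarrow> m' \<le> N \<Longrightarrow> b m < a m'" for m m'
  proof (induction m')
    case (Suc m')
    thus ?case using ab[of m'] ba[of m'] by (cases "m = m'") auto
  qed simp
  have mono_a: "a m \<le> a m'" if "m \<le> m'" "m' \<le> N" for m m'
    using that later[of m m'] ab[of m] by (cases "m = m'") auto
  have mono_b: "b m \<le> b m'" if "m \<le> m'" "m' < N" for m m'
    using that later[of m m'] ab[of m'] by (cases "m = m'") auto
  {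
    fix n assume "n \<in> {k. coeff (cyclotomic (p * q)) k \<noteq> 0}"
    then consider "n \<in> ?S" "n = 0 \<or> n - 1 \<notin> ?S" | "n \<notin> ?S" "n > 0" "n - 1 \<in> ?S"
      by (auto simp: coeff of_bool_def split: if_splits)
    thus "n \<in> a ` {..N} \<union> b ` {..<N}"
    proof cases
      case 1
      then consider "a N \<le> n" | m where "m < N" "a m \<le> n" "n < b m"
        unfolding S by blast
      thus ?thesis
      proof cases
        case 1
        hence "n = a N" using \<open>n = 0 \<or> n - 1 \<notin> ?S\<close> unfolding S by force
        thus ?thesis by auto
      next
        case (2 m)
        hence "n = a m" using \<open>n = 0 \<or> n - 1 \<notin> ?S\<close> unfolding S by force
        thus ?thesis using 2 by auto
      qed
    next
      case 2
      then consider "a N \<le> n - 1" | m where "m < N" "a m \<le> n - 1" "n - 1 < b m"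
        unfolding S by blast
      thus ?thesis
      proof cases
        case 1
        hence "a N \<le> n" by simp
        thus ?thesis using \<open>n \<notin> ?S\<close> S by blast
      next
        case (2 m)
        hence "n = b m" using \<open>n \<notin> ?S\<close> unfolding S by force
        thus ?thesis using 2 by auto
      qed
    qed
  next
    fix n assume "n \<in> a ` {..N} \<union> b ` {..<N}"
    then consider m where "m \<le> N" "n = a m" | m where "m < N" "n = b m" by auto
    thus "n \<in> {k. coeff (cyclotomic (p * q)) k \<noteq> 0}"
    proof cases
      case (1 m)
      have "n \<in> ?S"
        unfolding S using 1 ab[of m] by (cases "m = N") auto
      moreover have "\<not> (n > 0 \<and> n - 1 \<in> ?S)"
      proof
        assume *: "n > 0 \<and> n - 1 \<in> ?S"
        then consider "a N \<le> n - 1" | m' where "m' < N" "a m' \<le> n - 1" "n - 1 < b m'"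
          unfolding S by blast
        thus False
        proof cases
          case 1
          hence "a N < n" using * by linarith
          thus ?thesis using mono_a[of m N] \<open>m \<le> N\<close> \<open>n = a m\<close> by simp
        next
          case (2 m')
          thus ?thesis
            using * mono_a[of m m'] later[of m' m] \<open>m \<le> N\<close> \<open>n = a m\<close> by (cases "m \<le> m'") auto
        qed
      qed
      ultimately show ?thesis by (simp add: coeff)
    next
      case (2 m)
      have "n > 0" "n - 1 \<in> ?S"
        unfolding S using 2 ab[of m] by (auto intro!: disjI2 exI[of _ m])
      moreover have "n \<notin> ?S"
      proof
        assume "n \<in> ?S"
        then consider "a N \<le> n" | m' where "m' < N" "a m' \<le> n" "n < b m'"
          unfolding S by blast
        thus False
        proof cases
          case 1
          thus ?thesis using later[of m N] 2 by simp
        next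
          case (2 m')
          thus ?thesis
            using mono_b[of m' m] later[of m m'] \<open>m < N\<close> \<open>n = b m\<close> by (cases "m' \<le> m") auto
        qed
      qed
      ultimately show ?thesis by (simp add: coeff)
    qed
  }
qed

section \<open>The runs for \<open>q \<equiv> \<plusminus>1\<close> modulo \<open>p\<close>\<close>

text \<open>
  Among the representations of \<open>n\<close> with integer coefficients, the coefficient of \<open>q\<close> is determined
  modulo \<open>p\<close>; so the one with that coefficient in \<open>{0, \<dots>, p - 1}\<close> decides membership.
\<close>
lemma semigroup_gen_iff_class:
  assumes "coprime p q" "c < p" "[c * q = n] (mod p)"
  shows "n \<in> semigroup_gen p q \<longleftrightarrow> c * q \<le> n"
proof
  assume "n \<in> semigroup_gen p q"
  then obtain a b where ab: "n = a * p + b * q" "b < p"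
    using assms(2) by (auto elim: semigroup_gen_normal_form)
  hence "[c * q = b * q] (mod p)"
    using assms(3) by (simp add: cong_def)
  hence "[c = b] (mod p)"
    using assms(1) by (simp add: cong_mult_rcancel_nat coprime_commute)
  hence "c = b" using assms(2) ab(2) by (simp add: cong_def)
  thus "c * q \<le> n" using ab by simp
next
  assume le: "c * q \<le> n"
  hence "p dvd n - c * q"
    using assms(3) le by (meson cong_altdef_nat cong_sym)
  then obtain a where "n - c * q = p * a" ..
  hence "n = a * p + c * q" using le by (simp add: mult.commute)
  thus "n \<in> semigroup_gen p q" by (auto simp: semigroup_gen_def)
qed

lemma card_div_eq:
  fixes k :: nat
  assumes "k > 0"
  shows "card {m \<in> {l..<u}. m div k = j} = min u (Suc j * k) - max l (j * k)"
proof -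
  have "m div k = j \<longleftrightarrow> j * k \<le> m \<and> m < Suc j * k" for m
    using less_eq_div_iff_mult_less_eq[OF assms, of j m] div_less_iff_less_mult[OF assms, of m "Suc j"]
    by linarith
  moreover have "{m \<in> {l..<u}. x \<le> m \<and> m < y} = {max l x..<min u y}" for x y
    by auto
  ultimately have "{m \<in> {l..<u}. m div k = j} = {max l (j * k)..<min u (Suc j * k)}"
    by (simp only:)
  thus ?thesis by simp
qed

lemma card_Suc_div_eq:
  fixes k :: nat
  assumes "k > 0"
  shows "card {m. m < N \<and> Suc m div k = j} = min (Suc N) (Suc j * k) - max 1 (j * k)"
proof -
  have "Suc ` {m. m < N \<and> Suc m div k = j} = {m \<in> {1..<Suc N}. m div k = j}"
  proof (intro equalityI subsetI)
    fix m assume "m \<in> {m \<in> {1..<Suc N}. m div k = j}"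
    thus "m \<in> Suc ` {m. m < N \<and> Suc m div k = j}"
      by (cases m) auto
  qed auto
  moreover have "card (Suc ` {m. m < N \<and> Suc m div k = j}) = card {m. m < N \<and> Suc m div k = j}"
    by (intro card_image) simp
  ultimately have "card {m. m < N \<and> Suc m div k = j} = card {m \<in> {1..<Suc N}. m div k = j}"
    by simp
  thus ?thesis by (simp only: card_div_eq[OF assms])
qed

text \<open>
  For \<open>n = m p + c\<close> the relevant multiple of \<open>q\<close> is \<open>c q = c k p + c\<close>, so that \<open>n\<close> is in the
  semigroup if and only if \<open>c k \<le> m\<close>.
\<close>
lemma num_gaps_remainder_1:
  fixes p q k :: nat
  assumes "prime p" "prime q" "q = k * p + 1" "1 \<le> i" "i \<le> p - 1"
  shows "num_gaps (cyclotomic (p * q)) i = 2 * k"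
proof -
  have k: "k > 0" using assms(2,3) by (cases k) auto
  have p: "p \<ge> 2" using assms(1) by (rule prime_ge_2_nat)
  have "p < q" using k assms(3) by (cases k) auto
  hence pq: "p \<noteq> q" "coprime p q" using assms by (auto simp: primes_coprime)
  \<comment> \<open>For \<open>m \<ge> (p - 1) k\<close> the condition \<open>c k \<le> m\<close> holds for all residues \<open>c\<close>.\<close>
  define N where "N = (p - 1) * k"
  define a where "a m = m * p" for m
  define b where "b m = m * p + m div k + 1" for m
  have small: "m div k < p - 1" if "m < N" for m
    using that k by (simp add: N_def less_mult_imp_div_less)
  have large: "p - 1 \<le> m div k" if "N \<le> m" for m
    using that k by (simp add: N_def less_eq_div_iff_mult_less_eq)
  have ab: "a m < b m" for m
    by (simp add: a_def b_def)
  have ba: "b m < a (Suc m)" if "m < N" for m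
    using small[OF that] by (simp add: a_def b_def)
  have S: "n \<in> semigroup_gen p q \<longleftrightarrow> a N \<le> n \<or> (\<exists>m<N. a m \<le> n \<and> n < b m)" for n
  proof -
    define m c where "m = n div p" and "c = n mod p"
    have n: "n = m * p + c" and c: "c < p" using p by (simp_all add: m_def c_def)
    have "c * q = p * (c * k) + c" by (simp add: assms(3) algebra_simps)
    hence "[c * q = n] (mod p)" by (simp add: cong_def n)
    hence "n \<in> semigroup_gen p q \<longleftrightarrow> c * q \<le> n"
      using pq c by (intro semigroup_gen_iff_class)
    also have "\<dots> \<longleftrightarrow> (c * k) * p \<le> m * p"
      by (simp add: n assms(3) algebra_simps)
    also have "\<dots> \<longleftrightarrow> c \<le> m div k"
      using k p by (simp add: less_eq_div_iff_mult_less_eq)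
    also have "\<dots> \<longleftrightarrow> a N \<le> n \<or> (\<exists>m<N. a m \<le> n \<and> n < b m)"
    proof (cases "m < N")
      case True
      have "m' = m" if "m' < N" "a m' \<le> n" "n < b m'" for m'
      proof -
        have "m' * p \<le> n" "n < Suc m' * p"
          using that ba[of m'] by (auto simp: a_def)
        thus ?thesis
          unfolding m_def by (intro div_nat_eqI[symmetric]) (simp_all add: mult.commute)
      qed
      moreover have "\<not> a N \<le> n"
        using True p by (simp add: a_def m_def div_less_iff_less_mult)
      moreover have "a m \<le> n" "n < b m \<longleftrightarrow> c \<le> m div k"
        by (auto simp: a_def b_def n)
      ultimately show ?thesis using True by blast
    next
      case False
      hence "N * p \<le> m * p" by simp
      hence "a N \<le> n" unfolding a_def n by (rule trans_le_add1)
      moreover have "c \<le> m div k" using large[of m] c False by simp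
      ultimately show ?thesis by blast
    qed
    finally show ?thesis .
  qed
  have "num_gaps (cyclotomic (p * q)) i =
      card {m. m < N \<and> b m - a m = i} + card {m. m < N \<and> a (Suc m) - b m = i}"
    using assms(1,2) pq(1) ab ba S by (rule num_gaps_cyclotomic_runs)
  also have "{m. m < N \<and> b m - a m = i} = {m \<in> {0..<N}. m div k = i - 1}"
    using assms(4) by (auto simp: a_def b_def)
  also have "{m. m < N \<and> a (Suc m) - b m = i} = {m \<in> {0..<N}. m div k = p - 1 - i}"
    using assms(4,5) small by (auto simp: a_def b_def)
  also have "card {m \<in> {0..<N}. m div k = i - 1} = k"
  proof -
    have "Suc (i - 1) * k \<le> N"
      unfolding N_def using assms(4,5) by (intro mult_le_mono1) simp
    thus ?thesis unfolding card_div_eq[OF k] by (simp add: min_absorb2)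
  qed
  also have "card {m \<in> {0..<N}. m div k = p - 1 - i} = k"
  proof -
    have "Suc (p - 1 - i) * k \<le> N"
      unfolding N_def using assms(4,5) by (intro mult_le_mono1) simp
    thus ?thesis unfolding card_div_eq[OF k] by (simp add: min_absorb2)
  qed
  finally show ?thesis by simp
qed

text \<open>
  For \<open>n = m p - c\<close> the relevant multiple of \<open>q\<close> is \<open>c q = c k p - c\<close>, so that \<open>n\<close> is in the
  semigroup if and only if \<open>c k \<le> m\<close>. The runs thus end, rather than begin, at multiples of \<open>p\<close>.
\<close>
lemma num_gaps_remainder_minus_1:
  fixes p q k :: nat
  assumes "prime p" "prime q" "p < q" "q + 1 = k * p" "1 \<le> i" "i \<le> p - 1"
  shows "num_gaps (cyclotomic (p * q)) i = (if i = p - 1 then 2 * k - 2 else 2 * k)"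
proof -
  have p: "p \<ge> 2" using assms(1) by (rule prime_ge_2_nat)
  have k2: "k \<ge> 2"
  proof (rule ccontr)
    assume "\<not> k \<ge> 2"
    hence "k * p \<le> 1 * p" by (intro mult_le_mono1) simp
    thus False using assms(3,4) by linarith
  qed
  hence k: "k > 0" by simp
  have pq: "p \<noteq> q" "coprime p q" using assms by (auto simp: primes_coprime)
  \<comment> \<open>The run that ends in \<open>m p\<close> for \<open>m = (p - 1) k - 1\<close> is followed at once by the run that starts
    at \<open>(m + 1) p - (p - 1)\<close>. The unbounded run therefore starts one index before \<open>(p - 1) k\<close>.\<close>
  define N where "N = (p - 1) * k - 1"
  define a where "a m = m * p - m div k" for m
  define b where "b m = m * p + 1" for m
  have "1 * 1 \<le> (p - 1) * k" using p k by (intro mult_le_mono) auto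
  hence Suc_N: "Suc N = (p - 1) * k" unfolding N_def by linarith
  have small: "m div k \<le> p - 2" if "m \<le> N" for m
  proof -
    have "m div k < p - 1"
      using that k Suc_N by (intro less_mult_imp_div_less) simp
    thus ?thesis by simp
  qed
  have large: "p - 1 \<le> m div k" if "N < m" for m
    using that k Suc_N by (simp add: less_eq_div_iff_mult_less_eq)
  have Suc_p: "p - 1 = Suc (p - 2)" using p by simp
  hence "N = (p - 2) * k + (k - 1)" unfolding N_def using k by simp
  hence "N div k = p - 2"
    using k by (intro div_nat_eqI) (simp_all add: mult.commute)
  hence aN: "a N = N * p - (p - 2)" by (simp add: a_def)
  have div_le: "m div k \<le> m * p" for m
  proof -
    have "m * 1 \<le> m * p" using p by (intro mult_le_mono2) simp
    thus ?thesis using div_le_dividend[of m k] by linarith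
  qed
  have ab: "a m < b m" for m
    by (simp add: a_def b_def)
  have ba: "b m < a (Suc m)" if "m < N" for m
    using small[of "Suc m"] that p by (simp add: a_def b_def)
  have S: "n \<in> semigroup_gen p q \<longleftrightarrow> a N \<le> n \<or> (\<exists>m<N. a m \<le> n \<and> n < b m)" for n
  proof -
    \<comment> \<open>Division with a nonpositive remainder \<open>- c\<close>.\<close>
    obtain m c where n: "n + c = m * p" and c: "c < p"
    proof
      show "n + (p - 1 - (n + p - 1) mod p) = (n + p - 1) div p * p"
        using p div_mult_mod_eq[of "n + p - 1" p] mod_less_divisor[of p "n + p - 1"] by linarith
      show "p - 1 - (n + p - 1) mod p < p" using p by simp
    qed
    have eq: "c * q + c = (c * k) * p"
      using assms(4) by (metis add.commute mult.assoc mult_Suc_right Suc_eq_plus1)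
    hence "[c * q + c = n + c] (mod p)" by (simp add: cong_def n)
    hence "[c * q = n] (mod p)" by (simp add: cong_add_rcancel_nat)
    hence "n \<in> semigroup_gen p q \<longleftrightarrow> c * q \<le> n"
      using pq c by (intro semigroup_gen_iff_class)
    also have "\<dots> \<longleftrightarrow> (c * k) * p \<le> m * p"
      using n eq by linarith
    also have "\<dots> \<longleftrightarrow> c \<le> m div k"
      using k p by (simp add: less_eq_div_iff_mult_less_eq)
    also have "\<dots> \<longleftrightarrow> a N \<le> n \<or> (\<exists>m<N. a m \<le> n \<and> n < b m)"
    proof -
      consider "m < N" | "m = N" | "m > N" by linarith
      thus ?thesis
      proof cases
        case 1
        have "m' = m" if "m' < N" "a m' \<le> n" "n < b m'" for m'
        proof -
          have "m' * p < n + p" "n \<le> m' * p"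
            using that small[of m'] p by (auto simp: a_def b_def)
          hence "m' * p < Suc m * p" "m * p < Suc m' * p"
            using n c by simp_all
          hence "m' < Suc m" "m < Suc m'" unfolding mult_less_cancel2 by simp_all
          thus ?thesis by simp
        qed
        moreover have "Suc m * p \<le> N * p"
          using 1 by (intro mult_le_mono1) simp
        hence "\<not> a N \<le> n"
          using n c p unfolding aN mult_Suc by linarith
        moreover have "n < b m" "a m \<le> n \<longleftrightarrow> c \<le> m div k"
          using n div_le[of m] by (auto simp: a_def b_def)
        ultimately show ?thesis using 1 by blast
      next
        case 2
        have no: "\<not> n < b m'" if "m' < N" for m'
        proof -
          have "Suc m' * p \<le> m * p" using that 2 by (intro mult_le_mono1) simp
          thus ?thesis using n c unfolding b_def mult_Suc by linarith
        qed
        have "a N \<le> n \<longleftrightarrow> c \<le> p - 2"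
        proof -
          have "p - 2 \<le> N * p"
            using div_le[of N] \<open>N div k = p - 2\<close> by simp
          moreover have "n + c = N * p" using n 2 by simp
          ultimately show ?thesis unfolding aN by arith
        qed
        thus ?thesis using no 2 \<open>N div k = p - 2\<close> by auto
      next
        case 3
        have "Suc N * p \<le> m * p" using 3 by (intro mult_le_mono1) simp
        hence "a N \<le> n" using n c unfolding aN mult_Suc by linarith
        moreover have "c \<le> m div k" using large[OF 3] c by simp
        ultimately show ?thesis by blast
      qed
    qed
    finally show ?thesis .
  qed
  have "num_gaps (cyclotomic (p * q)) i =
      card {m. m < N \<and> b m - a m = i} + card {m. m < N \<and> a (Suc m) - b m = i}"
    using assms(1,2) pq(1) ab ba S by (rule num_gaps_cyclotomic_runs)
  also have "{m. m < N \<and> b m - a m = i} = {m \<in> {0..<N}. m div k = i - 1}"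
    using assms(5) div_le by (auto simp: a_def b_def)
  also have "{m. m < N \<and> a (Suc m) - b m = i} = {m. m < N \<and> Suc m div k = p - 1 - i}"
  proof -
    have "a (Suc m) - b m = p - 1 - Suc m div k" for m
      by (simp add: a_def b_def)
    moreover have "Suc m div k \<le> p - 1" if "m < N" for m
      using small[of "Suc m"] that by simp
    ultimately show ?thesis using assms(6) by fastforce
  qed
  also have "card {m \<in> {0..<N}. m div k = i - 1} = (if i = p - 1 then k - 1 else k)"
  proof (cases "i = p - 1")
    case True
    have "(i - 1) * k + k = Suc N" using True unfolding Suc_N Suc_p by simp
    moreover have "Suc (i - 1) = i" "i * k = Suc N" using True assms(5) Suc_N by simp_all
    ultimately show ?thesis unfolding card_div_eq[OF k] using True k by simp
  next
    case False
    hence "Suc i * k \<le> Suc N"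
      unfolding Suc_N using assms(6) by (intro mult_le_mono1) simp
    hence "i * k \<le> N" using k unfolding mult_Suc by linarith
    moreover have "Suc (i - 1) = i" using assms(5) by simp
    ultimately show ?thesis unfolding card_div_eq[OF k]
      using False by (simp add: min_absorb2 diff_mult_distrib)
  qed
  also have "card {m. m < N \<and> Suc m div k = p - 1 - i} = (if i = p - 1 then k - 1 else k)"
  proof (cases "i = p - 1")
    case True
    have "1 * k \<le> (p - 1) * k" using p by (intro mult_le_mono1) simp
    thus ?thesis unfolding card_Suc_div_eq[OF k] Suc_N using True k by simp
  next
    case False
    have "Suc (p - 1 - i) * k \<le> Suc N"
      unfolding Suc_N using assms(5,6) by (intro mult_le_mono1) simp
    moreover have "1 * 1 \<le> (p - 1 - i) * k"
      using False assms(6) k by (intro mult_le_mono) auto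
    ultimately show ?thesis unfolding card_Suc_div_eq[OF k]
      using False by (simp add: min_absorb2 max_absorb2)
  qed
  finally show ?thesis by auto
qed

theorem theorem1p2:
  fixes p q :: nat
  assumes "prime p" and "prime q" and "odd p" and "odd q" and "p < q"
  shows "(p = 3 \<longrightarrow> num_gaps (cyclotomic (3 * q)) 2 = 2 * (q div 3)) \<and>
    (p \<ge> 5 \<and> q mod p = 1 \<longrightarrow>
      (\<forall>i. 2 \<le> i \<and> i \<le> p - 1 \<longrightarrow> num_gaps (cyclotomic (p * q)) i = 2 * (q div p))) \<and>
    (p \<ge> 5 \<and> q mod p = p - 1 \<longrightarrow>
      num_gaps (cyclotomic (p * q)) (p - 1) = 2 * (q div p) \<and>
      (\<forall>i. 2 \<le> i \<and> i \<le> p - 2 \<longrightarrow> num_gaps (cyclotomic (p * q)) i = 2 * (q div p) + 2))"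
proof -
  have decomp: "q = q div p * p + q mod p" by simp
  have remainder_1: "num_gaps (cyclotomic (p * q)) i = 2 * (q div p)"
    if "q mod p = 1" "1 \<le> i" "i \<le> p - 1" for i
    using num_gaps_remainder_1[OF assms(1,2) _ that(2,3)] decomp that(1) by metis
  have remainder_minus_1: "num_gaps (cyclotomic (p * q)) i =
      (if i = p - 1 then 2 * (q div p) else 2 * (q div p) + 2)"
    if "q mod p = p - 1" "1 \<le> i" "i \<le> p - 1" for i
  proof -
    have "q + 1 = (q div p + 1) * p"
      using decomp that(1) prime_gt_0_nat[OF assms(1)] by (simp add: algebra_simps)
    from num_gaps_remainder_minus_1[OF assms(1,2,5) this that(2,3)] show ?thesis by simp
  qed
  have "num_gaps (cyclotomic (3 * q)) 2 = 2 * (q div 3)" if "p = 3"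
  proof -
    have "\<not> 3 dvd q"
      using assms that primes_dvd_imp_eq[of 3 q] by auto
    hence "q mod 3 \<noteq> 0" by (simp add: dvd_eq_mod_eq_0)
    hence "q mod p = 1 \<or> q mod p = p - 1" unfolding that by linarith
    thus ?thesis using remainder_1[of 2] remainder_minus_1[of 2] that by auto
  qed
  thus ?thesis using remainder_1 remainder_minus_1 by auto
qed

end
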